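(* In the system $\mathbb{C}^4\otimes\mathbb{C}^4\otimes\mathbb{C}^4$, the set of five lattice-type GHZ states $$\mathcal{T}_5^{(2,3)}=\{\psi_0\otimes\psi_1,\ \psi_0\otimes\psi_6,\ \psi_0\otimes\psi_3,\ \psi_3\otimes\psi_0,\ \psi_4\otimes\psi_0\}$$ is a $(2,3)$-threshold set.
   Context: Three-qubit GHZ basis of $\mathbb{C}^2\otimes\mathbb{C}^2\otimes\mathbb{C}^2$ (parties $A,B,C$ in this order): $|\psi_{0}\rangle,|\psi_7\rangle=\frac{|000\rangle\pm|111\rangle}{\sqrt2}$, $|\psi_{1}\rangle,|\psi_6\rangle=\frac{|001\rangle\pm|110\rangle}{\sqrt2}$, $|\psi_{2}\rangle,|\psi_5\rangle=\frac{|010\rangle\pm|101\rangle}{\sqrt2}$, $|\psi_{3}\rangle,|\psi_4\rangle=\frac{|011\rangle\pm|100\rangle}{\sqrt2}$, where in each pair the first-named state has sign $+$ and the second has sign $-$. Write $\psi_i=|\psi_i\rangle\langle\psi_i|$; a pure state is identified with its density operator. The state $\psi_i\otimes\psi_j$ is regarded as a state of $\mathbb{C}^4\otimes\mathbb{C}^4\otimes\mathbb{C}^4$ in which party $A$ (resp. $B$, $C$) holds the first (resp. second, third) qubit of each of the two tensor factors. Local distinguishability: a set of orthogonal pure states, known in advance to the parties, is locally distinguishable if, when the parties share an unknown state from the set, they can determine with certainty which state it is by a protocol using only local operations (measurements on their own subsystems) and classical communication (LOCC). Otherwise it is locally indistinguishable. $(s,n)$-threshold set: a set of orthogonal states in an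 $n$-partite system is an $(s,n)$-threshold set ($s\le n$) if the states are locally distinguishable when any $s$ or more parties are combined (act jointly as one party), but locally indistinguishable when at most $s-1$ parties can combine. In particular, a set of orthogonal states of parties $A,B,C$ is a $(2,3)$-threshold set if it is locally distinguishable across each of the bipartitions $A|BC$, $B|CA$, $C|AB$, but locally indistinguishable when the three parties are fully separated ($A|B|C$). *)

theory Defs
  imports Complex_Main "HOL-Library.FuncSet" "HOL-Library.Disjoint_Sets"
begin

section \<open>Multipartite pure states\<close>

text \<open>
  The parties are the elements of a finite type \<open>'p\<close>, and party \<open>p\<close> holds the space
  \<open>\<complex>^(d p)\<close> with computational basis \<open>0, \<dots>, d p - 1\<close>. A vector of the joint space of all
  parties is given by its amplitudes on the product basis. Only the values of a tensor on
  \<open>configs UNIV d\<close> matter; \<open>is_state\<close> demands that the others vanish, so that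
  equality of functions is equality of state vectors.
\<close>

type_synonym 'p dims = "'p \<Rightarrow> nat"
type_synonym 'p tensor = "('p \<Rightarrow> nat) \<Rightarrow> complex"

definition configs :: "'p set \<Rightarrow> 'p dims \<Rightarrow> ('p \<Rightarrow> nat) set" where
  "configs S d = Pi\<^sub>E S (\<lambda>p. {..<d p})"

definition ip :: "'p dims \<Rightarrow> 'p tensor \<Rightarrow> 'p tensor \<Rightarrow> complex" where
  "ip d v w = (\<Sum>x\<in>configs UNIV d. cnj (v x) * w x)"

definition norm_sq :: "'p dims \<Rightarrow> 'p tensor \<Rightarrow> real" where
  "norm_sq d v = (\<Sum>x\<in>configs UNIV d. (cmod (v x))\<^sup>2)"

definition is_state :: "'p dims \<Rightarrow> 'p tensor \<Rightarrow> bool" where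
  "is_state d v \<longleftrightarrow> (\<forall>x. x \<notin> configs UNIV d \<longrightarrow> v x = 0) \<and> norm_sq d v = 1"

definition orthogonal_states :: "'p dims \<Rightarrow> 'p tensor set \<Rightarrow> bool" where
  "orthogonal_states d X \<longleftrightarrow>
     (\<forall>\<psi>\<in>X. is_state d \<psi>) \<and> pairwise (\<lambda>\<phi> \<psi>. ip d \<phi> \<psi> = 0) X"


section \<open>LOCC protocols\<close>

text \<open>
  An operator of a block \<open>S\<close> of parties is a matrix indexed by joint basis labels of the members
  of \<open>S\<close>; \<open>apply_block S d K v\<close> is \<open>(K \<otimes> I) v\<close>, where \<open>d\<close> are the dimensions before \<open>K\<close> acts.
\<close>

type_synonym 'p operator = "('p \<Rightarrow> nat) \<Rightarrow> ('p \<Rightarrow> nat) \<Rightarrow> complex"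

definition apply_block :: "'p set \<Rightarrow> 'p dims \<Rightarrow> 'p operator \<Rightarrow> 'p tensor \<Rightarrow> 'p tensor" where
  "apply_block S d K v = (\<lambda>x. \<Sum>y\<in>configs S d. K (restrict x S) y * v (override_on x y S))"

text \<open>
  In \<open>Measure S n e K T\<close> the block \<open>S\<close> performs a measurement with outcomes \<open>k < n\<close> and
  measurement operators \<open>K k\<close>, broadcasts the outcome, and the protocol goes on with \<open>T k\<close>. After
  outcome \<open>k\<close> the members \<open>p\<close> of \<open>S\<close> hold spaces of dimension \<open>e k p\<close>; these are arbitrary, which
  covers local ancillas and the discarding of subsystems. One Kraus operator per outcome is no
  restriction, since \<open>T\<close> may take equal values at different outcomes. \<open>Announce \<psi>\<close> ends the
  protocol with the answer \<open>\<psi>\<close>. Protocols have finitely many rounds and outcomes.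
\<close>

datatype 'p protocol =
    Announce "'p tensor"
  | Measure "'p set" nat "nat \<Rightarrow> 'p dims" "nat \<Rightarrow> 'p operator" "nat \<Rightarrow> 'p protocol"

text \<open>
  The measurement condition is \<open>\<Sum>\<^sub>k (K k)\<^sup>\<dagger> (K k) = I\<close> on the space of the block. The set \<open>P\<close>
  lists the blocks of parties that act jointly as one party.
\<close>

definition measurement :: "'p set \<Rightarrow> 'p dims \<Rightarrow> nat \<Rightarrow> (nat \<Rightarrow> 'p dims) \<Rightarrow> (nat \<Rightarrow> 'p operator) \<Rightarrow> bool"
  where
  "measurement S d n e K \<longleftrightarrow>
     (\<forall>y\<in>configs S d. \<forall>z\<in>configs S d.
        (\<Sum>k<n. \<Sum>x\<in>configs S (e k). cnj (K k x y) * K k x z) = (if y = z then 1 else 0))"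

primrec locc :: "'p set set \<Rightarrow> 'p protocol \<Rightarrow> 'p dims \<Rightarrow> bool" where
  "locc P (Announce \<psi>) d \<longleftrightarrow> True"
| "locc P (Measure S n e K T) d \<longleftrightarrow>
     S \<in> P \<and> measurement S d n e K \<and> (\<forall>k<n. locc P (T k) (override_on d (e k) S))"

text \<open>
  The probability that the protocol, run on \<open>v\<close>, ends with the answer \<open>\<psi>\<close>. States are not
  renormalised after a measurement, so the squared norm at a leaf is the probability of the
  sequence of outcomes leading to it.
\<close>

primrec prob :: "'p protocol \<Rightarrow> 'p dims \<Rightarrow> 'p tensor \<Rightarrow> 'p tensor \<Rightarrow> real" where
  "prob (Announce \<phi>) d v \<psi> = (if \<phi> = \<psi> then norm_sq d v else 0)"
| "prob (Measure S n e K T) d v \<psi> =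
     (\<Sum>k<n. prob (T k) (override_on d (e k) S) (apply_block S d (K k) v) \<psi>)"

definition locally_distinguishable :: "'p set set \<Rightarrow> 'p dims \<Rightarrow> 'p tensor set \<Rightarrow> bool" where
  "locally_distinguishable P d X \<longleftrightarrow> (\<exists>T. locc P T d \<and> (\<forall>\<psi>\<in>X. prob T d \<psi> \<psi> = 1))"


section \<open>Threshold sets\<close>

text \<open>
  The ways in which the parties can combine are the partitions of \<open>UNIV :: 'p set\<close>. For three
  parties and \<open>s = 2\<close>, those with a block of size at least 2 are the three bipartitions and the
  trivial partition, and the only one with all blocks of size at most 1 is the full separation.
\<close>

definition threshold_set :: "nat \<Rightarrow> nat \<Rightarrow> 'p::finite dims \<Rightarrow> 'p tensor set \<Rightarrow> bool" where
  "threshold_set s n d X \<longleftrightarrow>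
     n = card (UNIV :: 'p set) \<and> s \<le> n \<and> orthogonal_states d X \<and>
     (\<forall>P. partition_on UNIV P \<longrightarrow> (\<exists>S\<in>P. s \<le> card S) \<longrightarrow> locally_distinguishable P d X) \<and>
     (\<forall>P. partition_on UNIV P \<longrightarrow> (\<forall>S\<in>P. card S \<le> s - 1) \<longrightarrow> \<not> locally_distinguishable P d X)"


section \<open>The lattice-type GHZ states\<close>

datatype party = Alice | Bob | Charlie

instance party :: finite
proof
  have "UNIV = {Alice, Bob, Charlie}"
    using party.exhaust by blast
  then show "finite (UNIV :: party set)"
    by (metis finite.emptyI finite.insertI)
qed

definition ket :: "nat \<Rightarrow> nat \<Rightarrow> nat \<Rightarrow> party tensor" where
  "ket a b c = (\<lambda>x. if x Alice = a \<and> x Bob = b \<and> x Charlie = c then 1 else 0)"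

text \<open>\<open>ghz_pm \<sigma> a b c = (|a b c> + \<sigma> |1-a 1-b 1-c>) / \<surd>2\<close> for bits \<open>a\<close>, \<open>b\<close>, \<open>c\<close> and a sign \<open>\<sigma>\<close>.\<close>

definition ghz_pm :: "complex \<Rightarrow> nat \<Rightarrow> nat \<Rightarrow> nat \<Rightarrow> party tensor" where
  "ghz_pm \<sigma> a b c =
     (\<lambda>x. (ket a b c x + \<sigma> * ket (1 - a) (1 - b) (1 - c) x) / complex_of_real (sqrt 2))"

text \<open>The GHZ basis \<open>\<psi>\<^sub>0, \<dots>, \<psi>\<^sub>7\<close>; the index is meaningful below 8 only.\<close>

definition ghz :: "nat \<Rightarrow> party tensor" where
  "ghz i =
     [ghz_pm 1 0 0 0, ghz_pm 1 0 0 1, ghz_pm 1 0 1 0, ghz_pm 1 0 1 1,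
      ghz_pm (-1) 0 1 1, ghz_pm (-1) 0 1 0, ghz_pm (-1) 0 0 1, ghz_pm (-1) 0 0 0] ! i"

text \<open>
  The tensor product of two three-qubit vectors, where each party holds the corresponding qubits
  of both factors: the basis vector \<open>|i> \<otimes> |j>\<close> of a party is its basis vector \<open>2 * i + j\<close>.
\<close>

definition tensor_qubits :: "party tensor \<Rightarrow> party tensor \<Rightarrow> party tensor" (infixl "\<otimes>\<^sub>q" 70) where
  "\<phi> \<otimes>\<^sub>q \<chi> = (\<lambda>x. \<phi> (\<lambda>p. x p div 2) * \<chi> (\<lambda>p. x p mod 2))"

definition T5 :: "party tensor set" where
  "T5 = {ghz 0 \<otimes>\<^sub>q ghz 1, ghz 0 \<otimes>\<^sub>q ghz 6, ghz 0 \<otimes>\<^sub>q ghz 3, ghz 3 \<otimes>\<^sub>q ghz 0, ghz 4 \<otimes>\<^sub>q ghz 0}"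

end

theory Submission
  imports Defs
begin

text \<open>
  Across a bipartition, the single party measures in one fixed basis of \<open>\<complex>\<^sup>4\<close> for which the residual
  states of the other two parties are orthogonal for every outcome; the two parties then
  discriminate them by projections.

  For separated parties, each branch of a protocol acts by product functionals \<open>a \<otimes> b \<otimes> c\<close> that
  annihilate all but at most one of the five states. Let \<open>s\<^sub>i\<close> be the amplitudes of such a functional
  on the states and \<open>N\<close> the sum of its squared amplitudes on eight basis vectors. If
  \<open>s\<^sub>2 = 0\<close>, then \<open>|s\<^sub>1|\<^sup>2 = |t| |t'|\<close> for the two halves \<open>t\<close>, \<open>t'\<close> of \<open>s\<^sub>1\<close>. Since the functional is a
  product, exchanging the labels of one party in the products of terms of \<open>t\<close> and \<open>t'\<close> gives products
  of amplitudes of the eight basis vectors, so that \<open>2 |s\<^sub>1|\<^sup>2 \<le> N\<close> by AM-GM. The same holds for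
  \<open>s\<^sub>2\<close>, \<open>s\<^sub>4\<close>, \<open>s\<^sub>5\<close>, while \<open>|s\<^sub>3|\<^sup>2 \<le> N\<close> by Cauchy-Schwarz. Summing over all branches of a perfect
  protocol, and using that measurements preserve the total norm, gives the contradiction
  \<open>2 + 2 + 1 + 2 + 2 \<le> 8\<close>.
\<close>

section \<open>Probabilities in LOCC protocols\<close>

lemma finite_configs [simp]: "finite S \<Longrightarrow> finite (configs S d)"
  unfolding configs_def by (intro finite_PiE) auto

lemma configs_UNIV_iff: "x \<in> configs UNIV d \<longleftrightarrow> (\<forall>p. x p < d p)"
  by (auto simp: configs_def)

lemma norm_sq_nonneg [simp]: "norm_sq d v \<ge> 0"
  by (simp add: norm_sq_def sum_nonneg)

lemma norm_sq_eq_0_iff: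
  fixes d :: "'p::finite dims"
  shows "norm_sq d v = 0 \<longleftrightarrow> (\<forall>x\<in>configs UNIV d. v x = 0)"
  unfolding norm_sq_def by (subst sum_nonneg_eq_0_iff) auto

lemma ip_linear:
  "ip d (\<lambda>x. v x + v' x) w = ip d v w + ip d v' w"
  "ip d (\<lambda>x. v x - v' x) w = ip d v w - ip d v' w"
  "ip d (\<lambda>x. v x / c) w = ip d v w / cnj c"
  "ip d v (\<lambda>x. w x + w' x) = ip d v w + ip d v w'"
  "ip d v (\<lambda>x. w x - w' x) = ip d v w - ip d v w'"
  "ip d v (\<lambda>x. w x / c) = ip d v w / c"
  by (simp_all add: ip_def distrib_left distrib_right left_diff_distrib right_diff_distrib
      sum.distrib sum_subtractf sum_divide_distrib)

lemma apply_block_linear: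
  "apply_block S d K (\<lambda>x. v x + w x) = (\<lambda>x. apply_block S d K v x + apply_block S d K w x)"
  "apply_block S d K (\<lambda>x. v x - w x) = (\<lambda>x. apply_block S d K v x - apply_block S d K w x)"
  "apply_block S d K (\<lambda>x. v x / c) = (\<lambda>x. apply_block S d K v x / c)"
  by (simp_all add: apply_block_def fun_eq_iff distrib_left right_diff_distrib
      sum.distrib sum_subtractf sum_divide_distrib)

lemma norm_sq_cong: "(\<And>x. x \<in> configs UNIV d \<Longrightarrow> v x = w x) \<Longrightarrow> norm_sq d v = norm_sq d w"
  by (simp add: norm_sq_def)

section \<open>Conservation of the total squared norm under a measurement\<close>

lemma sum_configs_split:
  fixes d :: "'p::finite dims"
  shows "(\<Sum>x\<in>configs UNIV d. f x) =
    (\<Sum>x\<in>configs (- S) d. \<Sum>y\<in>configs S d. f (override_on x y S))"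
proof -
  have [simp]: "override_on (restrict x (- S)) (restrict x S) S = x" for x :: "'p \<Rightarrow> nat"
    by (auto simp: override_on_def)
  have "(\<Sum>x\<in>configs UNIV d. f x) =
      (\<Sum>(x, y)\<in>configs (- S) d \<times> configs S d. f (override_on x y S))"
    by (rule sum.reindex_bij_witness[of _ "\<lambda>(x, y). override_on x y S"
          "\<lambda>x. (restrict x (- S), restrict x S)"])
       (simp_all, auto simp: configs_def override_on_def restrict_def PiE_iff extensional_def fun_eq_iff)
  then show ?thesis
    by (simp add: sum.cartesian_product)
qed

lemma of_real_cmod_sum_sq:
  "complex_of_real ((cmod (\<Sum>y\<in>C. f y))\<^sup>2) = (\<Sum>y\<in>C. \<Sum>z\<in>C. cnj (f y) * f z)"
  by (simp add: complex_norm_square sum_distrib_left sum_distrib_right mult.commute del: of_real_power)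

text \<open>Expanding the squared moduli into double sums over \<open>y\<close>, \<open>z\<close>
  and moving the sums over \<open>k\<close> and \<open>x\<close> innermost turns the coefficient of
  \<open>cnj (w y) * w z\<close> into the matrix entry that the measurement condition fixes.\<close>

lemma measurement_sum_norm:
  assumes "measurement S d n e K" and fin: "finite (configs S d)"
  shows "(\<Sum>k<n. \<Sum>x\<in>configs S (e k). (cmod (\<Sum>y\<in>configs S d. K k x y * w y))\<^sup>2) =
    (\<Sum>y\<in>configs S d. (cmod (w y))\<^sup>2)"
proof -
  let ?C = "configs S d"
  have "complex_of_real (\<Sum>k<n. \<Sum>x\<in>configs S (e k). (cmod (\<Sum>y\<in>?C. K k x y * w y))\<^sup>2) =
      (\<Sum>k<n. \<Sum>x\<in>configs S (e k). \<Sum>y\<in>?C. \<Sum>z\<in>?C. cnj (K k x y * w y) * (K k x z * w z))"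
    by (simp add: of_real_cmod_sum_sq del: of_real_power)
  also have "\<dots> = (\<Sum>k<n. \<Sum>y\<in>?C. \<Sum>z\<in>?C. \<Sum>x\<in>configs S (e k).
      cnj (K k x y * w y) * (K k x z * w z))"
    by (rule sum.cong[OF refl], subst sum.swap, rule sum.cong[OF refl], rule sum.swap)
  also have "\<dots> = (\<Sum>y\<in>?C. \<Sum>z\<in>?C. \<Sum>k<n. \<Sum>x\<in>configs S (e k).
      cnj (K k x y * w y) * (K k x z * w z))"
    by (subst sum.swap, rule sum.cong[OF refl], rule sum.swap)
  also have "\<dots> = (\<Sum>y\<in>?C. \<Sum>z\<in>?C. cnj (w y) * w z *
      (\<Sum>k<n. \<Sum>x\<in>configs S (e k). cnj (K k x y) * K k x z))"
    by (simp add: sum_distrib_left mult_ac)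
  also have "\<dots> = (\<Sum>y\<in>?C. \<Sum>z\<in>?C. if y = z then cnj (w y) * w z else 0)"
    using assms(1) by (intro sum.cong refl) (simp add: measurement_def)
  also have "\<dots> = complex_of_real (\<Sum>y\<in>?C. (cmod (w y))\<^sup>2)"
    using fin by (simp add: complex_norm_square mult.commute del: of_real_power)
  finally show ?thesis
    using of_real_eq_iff by blast
qed

lemma measurement_norm_sq:
  fixes d :: "'p::finite dims"
  assumes "measurement S d n e K"
  shows "(\<Sum>k<n. norm_sq (override_on d (e k) S) (apply_block S d (K k) v)) = norm_sq d v"
proof -
  \<comment> \<open>An outcome changes dimensions only inside \<open>S\<close>. The labels outside
    range over the same set for every \<open>k\<close>, so they can be fixed first and the isometry
    applied in each slice.\<close>
  have outside: "configs (- S) (override_on d (e k) S) = configs (- S) d"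
    and inside: "configs S (override_on d (e k) S) = configs S (e k)" for k
    by (auto simp: configs_def override_on_def intro!: PiE_cong)
  have block: "apply_block S d (K k) v (override_on x z S) =
      (\<Sum>y\<in>configs S d. K k z y * v (override_on x y S))" if "z \<in> configs S (e k)" for k x z
  proof -
    have "restrict (override_on x z S) S = z"
      using that by (auto simp: configs_def override_on_def restrict_def PiE_iff extensional_def)
    moreover have "override_on (override_on x z S) y S = override_on x y S" for y
      by (auto simp: override_on_def)
    ultimately show ?thesis
      by (simp add: apply_block_def)
  qed
  have "(\<Sum>k<n. norm_sq (override_on d (e k) S) (apply_block S d (K k) v)) =
      (\<Sum>x\<in>configs (- S) d. \<Sum>k<n. \<Sum>z\<in>configs S (e k).
        (cmod (\<Sum>y\<in>configs S d. K k z y * v (override_on x y S)))\<^sup>2)"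
    unfolding norm_sq_def
    by (subst sum.swap) (simp add: sum_configs_split[of _ _ S] outside inside block)
  also have "\<dots> = norm_sq d v"
    unfolding norm_sq_def
    by (simp add: measurement_sum_norm[OF assms] sum_configs_split[of _ d S])
  finally show ?thesis .
qed

section \<open>Bounds on answer probabilities\<close>

lemma prob_nonneg: "prob T d v \<psi> \<ge> 0"
  by (induction T arbitrary: d v) (auto intro: sum_nonneg)

text \<open>\<open>apply_block\<close> can produce nonzero values outside \<open>configs\<close>, so
  vectors after a measurement are identified on \<open>configs\<close> only.\<close>

lemma prob_cong:
  assumes "\<And>x. x \<in> configs UNIV d \<Longrightarrow> v x = w x"
  shows "prob T d v \<psi> = prob T d w \<psi>"
  using assms
proof (induction T arbitrary: d v w)
  case (Announce \<phi>)
  then show ?case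
    by (simp add: norm_sq_cong[of d v w])
next
  case (Measure S n e K T)
  have "override_on x y S \<in> configs UNIV d"
    if "x \<in> configs UNIV (override_on d (e k) S)" "y \<in> configs S d" for x y k
    using that by (auto simp: configs_def override_on_def PiE_iff split: if_splits)
  then have eq: "apply_block S d (K k) v x = apply_block S d (K k) w x"
    if "x \<in> configs UNIV (override_on d (e k) S)" for x k
    using that Measure.prems by (simp add: apply_block_def)
  show ?case
    unfolding prob.simps by (intro sum.cong refl Measure.IH rangeI eq)
qed

lemma prob_zero: "prob T d (\<lambda>x. 0) \<psi> = 0"
  by (induction T arbitrary: d) (simp_all add: norm_sq_def apply_block_def)

text \<open>A leaf gives its whole norm to a single answer and measurements conserve the total; only
  answers outside \<open>F\<close> are lost.\<close>

lemma sum_prob_le_norm_sq: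
  fixes d :: "'p::finite dims"
  assumes "finite F"
  shows "locc P T d \<Longrightarrow> (\<Sum>\<psi>\<in>F. prob T d v \<psi>) \<le> norm_sq d v"
proof (induction T arbitrary: d v)
  case (Announce \<phi>)
  then show ?case
    using assms by simp
next
  case (Measure S n e K T)
  have "(\<Sum>\<psi>\<in>F. prob (Measure S n e K T) d v \<psi>) =
      (\<Sum>k<n. \<Sum>\<psi>\<in>F. prob (T k) (override_on d (e k) S) (apply_block S d (K k) v) \<psi>)"
    by simp (rule sum.swap)
  also have "\<dots> \<le> (\<Sum>k<n. norm_sq (override_on d (e k) S) (apply_block S d (K k) v))"
    using Measure by (intro sum_mono) auto
  also have "\<dots> = norm_sq d v"
    using Measure.prems by (intro measurement_norm_sq) simp
  finally show ?case .
qed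

section \<open>Protocols of single parties\<close>

text \<open>A product functional with local coefficient vectors \<open>a p\<close>. There is no
  conjugation: the vectors arise as rows of accumulated measurement operators.\<close>

definition product_amplitude ::
    "'p::finite dims \<Rightarrow> ('p \<Rightarrow> nat \<Rightarrow> complex) \<Rightarrow> 'p tensor \<Rightarrow> complex" where
  "product_amplitude d a v = (\<Sum>z\<in>configs UNIV d. (\<Prod>p\<in>UNIV. a p (z p)) * v z)"

text \<open>The tensor product of the matrices \<open>A p\<close> applied to \<open>v\<close>; the
  amplitude at \<open>x\<close> is the functional formed by the rows \<open>x p\<close>.\<close>

definition local_image ::
    "'p::finite dims \<Rightarrow> ('p \<Rightarrow> nat \<Rightarrow> nat \<Rightarrow> complex) \<Rightarrow> 'p tensor \<Rightarrow> 'p tensor" where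
  "local_image d A v = (\<lambda>x. product_amplitude d (\<lambda>p. A p (x p)) v)"

lemma local_image_id:
  fixes d :: "'p::finite dims"
  assumes "\<And>x. x \<notin> configs UNIV d \<Longrightarrow> v x = 0"
  shows "local_image d (\<lambda>_ i j. if i = j then 1 else 0) v = v"
proof
  fix x :: "'p \<Rightarrow> nat"
  have "(\<Prod>p\<in>UNIV. if x p = z p then 1 else 0) = (if x = z then 1 else (0::complex))"
    for z :: "'p \<Rightarrow> nat"
  proof (cases "x = z")
    case False
    then obtain p where "x p \<noteq> z p"
      by auto
    then have "(\<Prod>p\<in>UNIV. if x p = z p then 1 else (0::complex)) = 0"
      by (intro prod_zero) auto
    with False show ?thesis
      by simp
  qed simp
  then have "local_image d (\<lambda>_ i j. if i = j then 1 else 0) v x =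
      (\<Sum>z\<in>configs UNIV d. if x = z then v z else 0)"
    by (simp add: local_image_def product_amplitude_def if_distrib[of "\<lambda>t. t * _"] cong: if_cong)
  also have "\<dots> = v x"
    using assms by (simp add: sum.delta)
  finally show "local_image d (\<lambda>_ i j. if i = j then 1 else 0) v x = v x" .
qed

text \<open>An operator of one party multiplies only the factor \<open>A p\<close>, so a branch of
  single-party operations stays a product. The label \<open>i\<close> of that party is encoded as
  the block label \<open>restrict (\<lambda>_. i) {p}\<close>.\<close>

lemma apply_block_local_image:
  "apply_block {p} d' K (local_image d A v) =
   local_image d (A(p := \<lambda>i j. \<Sum>y\<in>configs {p} d'. K (restrict (\<lambda>_. i) {p}) y * A p (y p) j)) v"
  (is "_ = local_image d ?A v")
proof
  fix x :: "'a \<Rightarrow> nat"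
  have restr: "restrict x {p} = restrict (\<lambda>_. x p) {p}"
    by (auto simp: restrict_def)
  have split: "(\<Prod>q\<in>UNIV. f q) = f p * (\<Prod>q\<in>- {p}. f q)" for f :: "_ \<Rightarrow> complex"
    using prod.remove[of UNIV p f] by (simp add: Compl_eq_Diff_UNIV)
  have prod: "(\<Sum>y\<in>configs {p} d'. K (restrict x {p}) y *
        (\<Prod>q\<in>UNIV. A q (override_on x y {p} q) (z q))) =
      (\<Prod>q\<in>UNIV. ?A q (x q) (z q))" for z
  proof -
    have "(\<Prod>q\<in>- {p}. A q (override_on x y {p} q) (z q)) = (\<Prod>q\<in>- {p}. ?A q (x q) (z q))" for y
      by (rule prod.cong) (auto simp: override_on_def)
    then show ?thesis
      by (simp add: split restr sum_distrib_right mult.assoc)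
  qed
  have "apply_block {p} d' K (local_image d A v) x =
      (\<Sum>y\<in>configs {p} d'. \<Sum>z\<in>configs UNIV d. K (restrict x {p}) y *
        ((\<Prod>q\<in>UNIV. A q (override_on x y {p} q) (z q)) * v z))"
    by (simp add: apply_block_def local_image_def product_amplitude_def sum_distrib_left)
  also have "\<dots> = (\<Sum>z\<in>configs UNIV d. (\<Sum>y\<in>configs {p} d'. K (restrict x {p}) y *
        (\<Prod>q\<in>UNIV. A q (override_on x y {p} q) (z q))) * v z)"
    by (subst sum.swap) (simp add: sum_distrib_right mult.assoc)
  also have "\<dots> = local_image d ?A v x"
    by (simp only: prod local_image_def product_amplitude_def)
  finally show "apply_block {p} d' K (local_image d A v) x = local_image d ?A v x" .
qed

text \<open>Induction over the protocol with the product operator \<open>A\<close> accumulated so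
  far. At a leaf the amplitude bound is summed over all rows; at a measurement both sides are sums
  over the branches, and on the right the total norm is conserved.\<close>

lemma local_protocol_bound:
  fixes d d' :: "'p::finite dims" and c :: "'p tensor \<Rightarrow> real"
  assumes singletons: "\<And>S. S \<in> P \<Longrightarrow> \<exists>p. S = {p}"
    and finite: "finite X"
    and amplitude: "\<And>a \<psi>. \<psi> \<in> X \<Longrightarrow>
      (\<And>\<phi>. \<phi> \<in> X \<Longrightarrow> \<phi> \<noteq> \<psi> \<Longrightarrow> product_amplitude d a \<phi> = 0) \<Longrightarrow>
      c \<psi> * (cmod (product_amplitude d a \<psi>))\<^sup>2 \<le> (\<Sum>y\<in>Y. (cmod (product_amplitude d a y))\<^sup>2)"
    and "locc P T d'"
    and "\<And>\<phi> \<psi>. \<phi> \<in> X \<Longrightarrow> \<psi> \<in> X \<Longrightarrow> \<phi> \<noteq> \<psi> \<Longrightarrow> prob T d' (local_image d A \<phi>) \<psi> = 0"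
  shows "(\<Sum>\<psi>\<in>X. c \<psi> * prob T d' (local_image d A \<psi>) \<psi>) \<le>
    (\<Sum>y\<in>Y. norm_sq d' (local_image d A y))"
  using assms(4,5)
proof (induction T arbitrary: d' A)
  case (Announce \<phi>)
  show ?case
  proof (cases "\<phi> \<in> X")
    case True
    \<comment> \<open>Absence of errors at this leaf: every other state arrives with norm 0, so each
      row of the accumulated operator annihilates it.\<close>
    have zero: "product_amplitude d (\<lambda>p. A p (x p)) \<psi> = 0"
      if "\<psi> \<in> X" "\<psi> \<noteq> \<phi>" "x \<in> configs UNIV d'" for \<psi> x
      using Announce.prems(2)[of \<psi> \<phi>] True that by (auto simp: norm_sq_eq_0_iff local_image_def)
    have "(\<Sum>\<psi>\<in>X. c \<psi> * prob (Announce \<phi>) d' (local_image d A \<psi>) \<psi>) =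
        (\<Sum>\<psi>\<in>X. if \<phi> = \<psi> then c \<psi> * norm_sq d' (local_image d A \<psi>) else 0)"
      by (intro sum.cong) auto
    also have "\<dots> = c \<phi> * norm_sq d' (local_image d A \<phi>)"
      using True finite by simp
    also have "\<dots> = (\<Sum>x\<in>configs UNIV d'. c \<phi> * (cmod (local_image d A \<phi> x))\<^sup>2)"
      by (simp add: norm_sq_def sum_distrib_left)
    also have "\<dots> \<le> (\<Sum>x\<in>configs UNIV d'. \<Sum>y\<in>Y. (cmod (local_image d A y x))\<^sup>2)"
      unfolding local_image_def using True zero by (intro sum_mono amplitude) auto
    also have "\<dots> = (\<Sum>y\<in>Y. norm_sq d' (local_image d A y))"
      unfolding norm_sq_def by (rule sum.swap)
    finally show ?thesis .
  next
    case False
    then have "(\<Sum>\<psi>\<in>X. c \<psi> * prob (Announce \<phi>) d' (local_image d A \<psi>) \<psi>) = 0"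
      by (intro sum.neutral) auto
    then show ?thesis
      by (simp add: sum_nonneg)
  qed
next
  case (Measure S n e K T)
  obtain p where S: "S = {p}"
    using singletons Measure.prems(1) by auto
  define A' where "A' k = A(p := \<lambda>i j. \<Sum>y\<in>configs {p} d'. K k (restrict (\<lambda>_. i) {p}) y * A p (y p) j)"
    for k
  let ?d = "\<lambda>k. override_on d' (e k) S"
  have image: "apply_block S d' (K k) (local_image d A v) = local_image d (A' k) v" for k v
    unfolding S A'_def by (rule apply_block_local_image)
  have IH: "(\<Sum>\<psi>\<in>X. c \<psi> * prob (T k) (?d k) (local_image d (A' k) \<psi>) \<psi>) \<le>
      (\<Sum>y\<in>Y. norm_sq (?d k) (local_image d (A' k) y))" if "k < n" for k
  proof (rule Measure.IH)
    show "locc P (T k) (?d k)"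
      using Measure.prems(1) that by simp
    fix \<phi> \<psi>
    assume "\<phi> \<in> X" "\<psi> \<in> X" "\<phi> \<noteq> \<psi>"
    \<comment> \<open>The error probability is a sum of nonnegative branch probabilities, so its
      vanishing passes to each branch.\<close>
    then have "(\<Sum>k<n. prob (T k) (?d k) (local_image d (A' k) \<phi>) \<psi>) = 0"
      using Measure.prems(2)[of \<phi> \<psi>] by (simp add: image)
    then show "prob (T k) (?d k) (local_image d (A' k) \<phi>) \<psi> = 0"
      using that by (subst (asm) sum_nonneg_eq_0_iff) (auto simp: prob_nonneg)
  qed simp
  have "(\<Sum>\<psi>\<in>X. c \<psi> * prob (Measure S n e K T) d' (local_image d A \<psi>) \<psi>) =
      (\<Sum>k<n. \<Sum>\<psi>\<in>X. c \<psi> * prob (T k) (?d k) (local_image d (A' k) \<psi>) \<psi>)"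
    by (simp add: image sum_distrib_left) (rule sum.swap)
  also have "\<dots> \<le> (\<Sum>k<n. \<Sum>y\<in>Y. norm_sq (?d k) (local_image d (A' k) y))"
    using IH by (intro sum_mono) auto
  also have "\<dots> = (\<Sum>y\<in>Y. \<Sum>k<n. norm_sq (?d k) (apply_block S d' (K k) (local_image d A y)))"
    by (simp add: image) (rule sum.swap)
  also have "\<dots> = (\<Sum>y\<in>Y. norm_sq d' (local_image d A y))"
    using Measure.prems(1) by (intro sum.cong refl measurement_norm_sq) simp
  finally show ?case .
qed

text \<open>The preceding induction is started at the identity of every party, where all success
  probabilities are 1.\<close>

lemma locally_distinguishable_bound:
  fixes d :: "'p::finite dims" and c :: "'p tensor \<Rightarrow> real"
  assumes singletons: "\<And>S. S \<in> P \<Longrightarrow> \<exists>p. S = {p}"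
    and finite: "finite X"
    and states: "\<And>\<psi>. \<psi> \<in> X \<Longrightarrow> is_state d \<psi>"
    and support: "\<And>y x. y \<in> Y \<Longrightarrow> x \<notin> configs UNIV d \<Longrightarrow> y x = 0"
    and amplitude: "\<And>a \<psi>. \<psi> \<in> X \<Longrightarrow>
      (\<And>\<phi>. \<phi> \<in> X \<Longrightarrow> \<phi> \<noteq> \<psi> \<Longrightarrow> product_amplitude d a \<phi> = 0) \<Longrightarrow>
      c \<psi> * (cmod (product_amplitude d a \<psi>))\<^sup>2 \<le> (\<Sum>y\<in>Y. (cmod (product_amplitude d a y))\<^sup>2)"
    and "locally_distinguishable P d X"
  shows "sum c X \<le> sum (norm_sq d) Y"
proof -
  obtain T where T: "locc P T d" and succ: "\<And>\<psi>. \<psi> \<in> X \<Longrightarrow> prob T d \<psi> \<psi> = 1"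
    using assms(6) by (auto simp: locally_distinguishable_def)
  let ?I = "\<lambda>_ i j. if i = j then 1 else 0"
  have image: "local_image d ?I \<psi> = \<psi>" if "\<psi> \<in> X \<union> Y" for \<psi>
    using that states support by (intro local_image_id) (auto simp: is_state_def)
  \<comment> \<open>On \<open>\<phi>\<close> the correct answer already uses up the total
    probability 1.\<close>
  have "prob T d \<phi> \<psi> = 0" if "\<phi> \<in> X" "\<psi> \<in> X" "\<phi> \<noteq> \<psi>" for \<phi> \<psi>
  proof -
    have "(\<Sum>\<chi>\<in>{\<phi>, \<psi>}. prob T d \<phi> \<chi>) \<le> norm_sq d \<phi>"
      by (rule sum_prob_le_norm_sq[OF _ T]) simp
    then have "1 + prob T d \<phi> \<psi> \<le> 1"
      using that states succ by (simp add: is_state_def)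
    then show ?thesis
      using prob_nonneg[of T d \<phi> \<psi>] by simp
  qed
  then have "(\<Sum>\<psi>\<in>X. c \<psi> * prob T d (local_image d ?I \<psi>) \<psi>) \<le>
      (\<Sum>y\<in>Y. norm_sq d (local_image d ?I y))"
    by (intro local_protocol_bound[OF singletons finite amplitude T]) (auto simp: image)
  then show ?thesis
    by (simp add: image succ)
qed

section \<open>Discrimination by two blocks\<close>

text \<open>The assumption \<open>unit\<close> says that \<open>u\<close> has norm 1 or vanishes on
  \<open>C\<close> with no weight left elsewhere. In both cases \<open>u\<close> times its adjoint
  is a projection, and \<open>M\<close> is the complementary one.\<close>

lemma projective_measurement:
  fixes u :: "'a \<Rightarrow> complex"
  assumes "finite C"
    and unit: "\<And>y. (\<Sum>x\<in>C. cnj (u x) * u x) * u y = u y"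
    and "y \<in> C" "z \<in> C"
    and M: "M = (\<lambda>x y. (if x = y then 1 else 0) - u x * cnj (u y))"
  shows "(\<Sum>x\<in>C. cnj (u x * cnj (u y)) * (u x * cnj (u z))) + (\<Sum>x\<in>C. cnj (M x y) * M x z) =
    (if y = z then 1 else 0)"
proof -
  let ?s = "\<Sum>x\<in>C. cnj (u x) * u x"
  have "(\<Sum>x\<in>C. cnj (u x * cnj (u y)) * (u x * cnj (u z))) = ?s * u y * cnj (u z)"
    by (simp add: sum_distrib_left sum_distrib_right mult_ac)
  then have "(\<Sum>x\<in>C. cnj (u x * cnj (u y)) * (u x * cnj (u z))) = u y * cnj (u z)"
    using unit by simp
  moreover have "cnj (M x y) * M x z = (if x = y then M x z else 0) -
      (if x = z then u y * cnj (u x) else 0) + cnj (u x * cnj (u y)) * (u x * cnj (u z))" for x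
    by (simp add: M algebra_simps)
  ultimately show ?thesis
    using assms(1,3,4) by (simp add: sum.distrib sum_subtractf) (simp add: M)
qed

lemma orthogonal_discrimination:
  fixes d :: "'p::finite dims"
  assumes "S \<in> P" and trivial: "\<And>p. p \<notin> S \<Longrightarrow> d p = 1"
    and "finite I"
    and "\<And>i j. i \<in> I \<Longrightarrow> j \<in> I \<Longrightarrow> i \<noteq> j \<Longrightarrow> ip d (v i) (v j) = 0"
  shows "\<exists>T. locc P T d \<and> (\<forall>i\<in>I. prob T d (v i) (\<psi> i) = norm_sq d (v i))"
  using assms(3,4)
proof (induction I)
  case empty
  have "locc P (Announce undefined) d"
    by simp
  then show ?case
    by blast
next
  case (insert i I)
  then obtain T where T: "locc P T d" "\<And>j. j \<in> I \<Longrightarrow> prob T d (v j) (\<psi> j) = norm_sq d (v j)"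
    by (metis insertCI)
  let ?U = "configs UNIV d"
  \<comment> \<open>If \<open>v i\<close> vanishes, the division by zero makes \<open>u = 0\<close>, and the test below is trivial.\<close>
  define u where "u x = v i x / complex_of_real (sqrt (norm_sq d (v i)))" for x
  define M :: "nat \<Rightarrow> ('p \<Rightarrow> nat) \<Rightarrow> ('p \<Rightarrow> nat) \<Rightarrow> complex" where
    "M k x y = (if k = 0 then u x * cnj (u y) else (if x = y then 1 else 0) - u x * cnj (u y))" for k x y
  \<comment> \<open>Padding by 0, the only label of a one-dimensional party, identifies the labels
    of the block with those of the whole system.\<close>
  define ext where "ext x = override_on (\<lambda>_. 0) x S" for x :: "'p \<Rightarrow> nat"
  define K where "K k x y = M k (ext x) (ext y)" for k x y
  define Q where "Q = Measure S 2 (\<lambda>_. d) K (\<lambda>k. if k = 0 then Announce (\<psi> i) else T)"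
  have outside: "x p = 0" if "x \<in> ?U" "p \<notin> S" for x p
    using that trivial[of p] by (auto simp: configs_UNIV_iff dest: spec[of _ p])
  have sum_ext: "(\<Sum>y\<in>configs S d. f (ext y)) = (\<Sum>y\<in>?U. f y)" for f :: "_ \<Rightarrow> complex"
    by (rule sum.reindex_bij_witness[of _ "\<lambda>x. restrict x S" ext])
       (use trivial outside in \<open>auto simp: configs_def ext_def override_on_def restrict_def PiE_iff
          extensional_def fun_eq_iff\<close>)
  have ext_in: "ext y \<in> ?U" if "y \<in> configs S d" for y
    using that trivial by (auto simp: configs_def ext_def override_on_def PiE_iff)
  have ext_inj: "ext y = ext z \<longleftrightarrow> y = z" if "y \<in> configs S d" "z \<in> configs S d" for y z
    using that by (auto simp: configs_def ext_def override_on_def PiE_iff extensional_def fun_eq_iff)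
       (metis)
  have norm: "(\<Sum>x\<in>?U. cnj (v i x) * v i x) = complex_of_real (norm_sq d (v i))"
    by (simp add: norm_sq_def complex_norm_square mult.commute del: of_real_power)
  have u_out: "u y = 0" if "norm_sq d (v i) = 0" for y
    using that by (simp add: u_def)
  have sqrt_sq: "complex_of_real (sqrt (norm_sq d (v i))) * complex_of_real (sqrt (norm_sq d (v i))) =
      complex_of_real (norm_sq d (v i))"
    by (simp flip: of_real_mult)
  have uu: "(\<Sum>x\<in>?U. cnj (u x) * u x) = (if norm_sq d (v i) = 0 then 0 else 1)"
    using norm by (simp add: u_def sqrt_sq flip: sum_divide_distrib)
  have unit: "(\<Sum>x\<in>?U. cnj (u x) * u x) * u y = u y" for y
    by (simp add: uu u_out)
  have meas: "measurement S d 2 (\<lambda>_. d) K"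
    unfolding measurement_def
  proof (intro ballI)
    fix y z assume yz: "y \<in> configs S d" "z \<in> configs S d"
    have "(\<Sum>k<2. \<Sum>x\<in>configs S d. cnj (K k x y) * K k x z) =
        (\<Sum>k<2. \<Sum>x\<in>?U. cnj (M k x (ext y)) * M k x (ext z))"
      unfolding K_def by (intro sum.cong refl sum_ext)
    also have "\<dots> = (if ext y = ext z then 1 else 0)"
      using projective_measurement[OF _ unit ext_in[OF yz(1)] ext_in[OF yz(2)] refl]
      by (simp add: M_def numeral_2_eq_2)
    finally show "(\<Sum>k<2. \<Sum>x\<in>configs S d. cnj (K k x y) * K k x z) = (if y = z then 1 else 0)"
      using ext_inj[OF yz] by simp
  qed
  have [simp]: "override_on d d S = d"
    by (auto simp: override_on_def)
  have locc: "locc P Q d"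
    unfolding Q_def using meas T(1) assms(1) by simp
  have block: "apply_block S d (K k) w x = (\<Sum>y\<in>?U. M k x y * w y)" if "x \<in> ?U" for k w x
  proof -
    have x: "ext (restrict x S) = x"
      using outside[OF that] by (auto simp: ext_def override_on_def fun_eq_iff)
    have "override_on x y S = ext y" for y
      using outside[OF that] by (auto simp: ext_def override_on_def fun_eq_iff)
    then have "apply_block S d (K k) w x = (\<Sum>y\<in>configs S d. M k x (ext y) * w (ext y))"
      by (simp add: apply_block_def K_def x)
    then show ?thesis
      using sum_ext[of "\<lambda>y. M k x y * w y"] by simp
  qed
  have apply0: "apply_block S d (K 0) w x = u x * ip d u w" if "x \<in> ?U" for w x
    using that by (simp add: block M_def ip_def sum_distrib_left mult.assoc)
  have apply1: "apply_block S d (K (Suc 0)) w x = w x - u x * ip d u w" if "x \<in> ?U" for w x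
  proof -
    have "apply_block S d (K (Suc 0)) w x =
        (\<Sum>y\<in>?U. (if x = y then w y else 0) - u x * (cnj (u y) * w y))"
      unfolding block[OF that] by (rule sum.cong) (auto simp: M_def algebra_simps)
    then show ?thesis
      using that by (simp add: sum_subtractf ip_def sum_distrib_left)
  qed
  have prob: "prob Q d w \<phi> = (if \<psi> i = \<phi> then norm_sq d (\<lambda>x. u x * ip d u w) else 0) +
      prob T d (\<lambda>x. w x - u x * ip d u w) \<phi>" for w \<phi>
    unfolding Q_def
    using norm_sq_cong[of d "apply_block S d (K 0) w", OF apply0]
      prob_cong[of d "apply_block S d (K (Suc 0)) w", OF apply1]
    by (simp add: numeral_2_eq_2)
  \<comment> \<open>The vector \<open>v i\<close> passes the test with its whole norm and leaves the
    zero vector to \<open>T\<close>; each other vector reaches \<open>T\<close> unchanged.\<close>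
  have "prob Q d (v j) (\<psi> j) = norm_sq d (v j)" if "j \<in> insert i I" for j
  proof (cases "j = i")
    case True
    have "u x * ip d u (v i) = v i x" if "x \<in> ?U" for x
    proof (cases "norm_sq d (v i) = 0")
      case True
      then show ?thesis
        using that by (simp add: u_out norm_sq_eq_0_iff)
    next
      case False
      have "ip d u (v i) = complex_of_real (norm_sq d (v i)) / complex_of_real (sqrt (norm_sq d (v i)))"
        unfolding ip_def using norm by (simp add: u_def flip: sum_divide_distrib)
      then show ?thesis
        using False by (simp add: u_def sqrt_sq)
    qed
    then have "norm_sq d (\<lambda>x. u x * ip d u (v i)) = norm_sq d (v i)"
      and "prob T d (\<lambda>x. v i x - u x * ip d u (v i)) (\<psi> i) = prob T d (\<lambda>x. 0) (\<psi> i)"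
      by (auto intro!: norm_sq_cong prob_cong)
    then show ?thesis
      unfolding True by (simp add: prob prob_zero)
  next
    case False
    have "ip d (v i) (v j) = 0"
      using False that insert.prems by auto
    then have "ip d u (v j) = 0"
      by (simp add: ip_def u_def flip: sum_divide_distrib)
    then show ?thesis
      using False that T(2) by (simp add: prob norm_sq_def)
  qed
  with locc show ?case
    by blast
qed

lemma locally_distinguishable_one_block:
  fixes d :: "'p::finite dims"
  assumes "UNIV \<in> P" "finite X" "orthogonal_states d X"
  shows "locally_distinguishable P d X"
proof -
  have "\<exists>T. locc P T d \<and> (\<forall>\<psi>\<in>X. prob T d \<psi> \<psi> = norm_sq d \<psi>)"
    using assms by (intro orthogonal_discrimination[of UNIV P d X "\<lambda>\<psi>. \<psi>" "\<lambda>\<psi>. \<psi>"])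
      (auto simp: orthogonal_states_def pairwise_def)
  then show ?thesis
    using assms(3) by (auto simp: locally_distinguishable_def orthogonal_states_def is_state_def)
qed

text \<open>All output dimensions of the measurement are 1, so afterwards the block
  \<open>- S\<close> holds the entire residual state and can discriminate by projections. The
  residual norms of a state add up to 1.\<close>

lemma locally_distinguishable_two_blocks:
  fixes d :: "'p::finite dims"
  assumes "S \<in> P" "- S \<in> P" "finite X"
    and states: "\<And>\<psi>. \<psi> \<in> X \<Longrightarrow> is_state d \<psi>"
    and meas: "measurement S d n (\<lambda>_ _. 1) K"
    and orth: "\<And>k \<phi> \<psi>. k < n \<Longrightarrow> \<phi> \<in> X \<Longrightarrow> \<psi> \<in> X \<Longrightarrow> \<phi> \<noteq> \<psi> \<Longrightarrow>
      ip (override_on d (\<lambda>_. 1) S) (apply_block S d (K k) \<phi>) (apply_block S d (K k) \<psi>) = 0"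
  shows "locally_distinguishable P d X"
proof -
  let ?d = "override_on d (\<lambda>_. 1) S"
  have "\<exists>T. locc P T ?d \<and> (\<forall>\<psi>\<in>X. prob T ?d (apply_block S d (K k) \<psi>) \<psi> =
      norm_sq ?d (apply_block S d (K k) \<psi>))" if "k < n" for k
    using assms(2,3) that orth
    by (intro orthogonal_discrimination[of "- S" P ?d X "apply_block S d (K k)" "\<lambda>\<psi>. \<psi>"]) auto
  then obtain T where T: "\<And>k. k < n \<Longrightarrow> locc P (T k) ?d"
      "\<And>k \<psi>. k < n \<Longrightarrow> \<psi> \<in> X \<Longrightarrow> prob (T k) ?d (apply_block S d (K k) \<psi>) \<psi> =
        norm_sq ?d (apply_block S d (K k) \<psi>)"
    by metis
  let ?Q = "Measure S n (\<lambda>_ _. 1) K T"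
  have "locc P ?Q d"
    using assms(1) meas T(1) by simp
  moreover have "prob ?Q d \<psi> \<psi> = 1" if "\<psi> \<in> X" for \<psi>
    using measurement_norm_sq[OF meas, of \<psi>] states[OF that] T(2) that by (simp add: is_state_def)
  ultimately show ?thesis
    unfolding locally_distinguishable_def by blast
qed

section \<open>The five lattice-type GHZ states\<close>

lemma UNIV_party: "UNIV = {Alice, Bob, Charlie}"
  using party.exhaust by blast

lemma card_UNIV_party: "card (UNIV :: party set) = 3"
  by (simp add: UNIV_party)

lemma sum_configs_party:
  "(\<Sum>x\<in>configs UNIV d. f x) =
    (\<Sum>i<d Alice. \<Sum>j<d Bob. \<Sum>l<d Charlie. f (case_party i j l))"
proof -
  have [simp]: "case_party (x Alice) (x Bob) (x Charlie) = x" for x :: "party \<Rightarrow> nat"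
    by (rule ext) (simp split: party.split)
  have "(\<Sum>x\<in>configs UNIV d. f x) =
      (\<Sum>(i, j, l)\<in>{..<d Alice} \<times> {..<d Bob} \<times> {..<d Charlie}. f (case_party i j l))"
    by (rule sum.reindex_bij_witness[of _ "\<lambda>(i, j, l). case_party i j l"
          "\<lambda>x. (x Alice, x Bob, x Charlie)"])
       (auto simp: configs_UNIV_iff split: party.split)
  then show ?thesis
    by (simp add: sum.cartesian_product)
qed

section \<open>The product basis of three parties\<close>

lemma inj_ket: "inj (\<lambda>(a, b, c). ket a b c)"
proof -
  have "a = a' \<and> b = b' \<and> c = c'" if "ket a b c = ket a' b' c'" for a b c a' b' c'
    using fun_cong[OF that, of "case_party a b c"] by (simp add: ket_def split: if_splits)
  then show ?thesis
    by (auto simp: inj_def)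
qed

lemma ket_outside_configs:
  assumes "a < n" "b < n" "c < n" "x \<notin> configs UNIV (\<lambda>_. n)"
  shows "ket a b c x = 0"
proof -
  obtain p where "x p \<ge> n"
    using assms(4) by (auto simp: configs_UNIV_iff not_less)
  then show ?thesis
    using assms(1-3) by (cases p) (auto simp: ket_def)
qed

lemma ket_eq_delta: "ket a b c x = (if x = case_party a b c then 1 else 0)"
  by (auto simp: ket_def fun_eq_iff split: party.split)

lemma norm_sq_ket: "a < n \<Longrightarrow> b < n \<Longrightarrow> c < n \<Longrightarrow> norm_sq (\<lambda>_. n) (ket a b c) = 1"
  by (simp add: norm_sq_def ket_eq_delta if_distrib[of cmod] if_distrib[of "\<lambda>t. t\<^sup>2"]
      configs_UNIV_iff split: party.split cong: if_cong)

lemma ip_ket: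
  assumes "a < n" "b < n" "c < n"
  shows "ip (\<lambda>_. n) (ket a b c) (ket a' b' c') = (if a = a' \<and> b = b' \<and> c = c' then 1 else 0)"
proof -
  have in_configs: "case_party a b c \<in> configs UNIV (\<lambda>_. n)"
    using assms by (auto simp: configs_UNIV_iff split: party.split)
  have "ip (\<lambda>_. n) (ket a b c) (ket a' b' c') =
      (\<Sum>x\<in>configs UNIV (\<lambda>_. n). if x = case_party a b c then ket a' b' c' x else 0)"
    unfolding ip_def by (intro sum.cong) (auto simp: ket_eq_delta)
  also have "\<dots> = ket a' b' c' (case_party a b c)"
    using in_configs by simp
  finally show ?thesis
    by (simp add: ket_def)
qed

lemma product_amplitude_ket:
  assumes "i < n" "j < n" "l < n"
  shows "product_amplitude (\<lambda>_. n) a (ket i j l) = a Alice i * a Bob j * a Charlie l"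
proof -
  have in_configs: "case_party i j l \<in> configs UNIV (\<lambda>_. n)"
    using assms by (auto simp: configs_UNIV_iff split: party.split)
  have "product_amplitude (\<lambda>_. n) a (ket i j l) =
      (\<Sum>z\<in>configs UNIV (\<lambda>_. n). if z = case_party i j l then \<Prod>p\<in>UNIV. a p (z p) else 0)"
    unfolding product_amplitude_def by (intro sum.cong) (auto simp: ket_eq_delta)
  also have "\<dots> = (\<Prod>p\<in>UNIV. a p (case_party i j l p))"
    using in_configs by simp
  also have "\<dots> = a Alice i * a Bob j * a Charlie l"
    by (simp add: UNIV_party)
  finally show ?thesis .
qed

lemma product_amplitude_linear:
  "product_amplitude d a (\<lambda>x. v x + w x) = product_amplitude d a v + product_amplitude d a w"
  "product_amplitude d a (\<lambda>x. v x - w x) = product_amplitude d a v - product_amplitude d a w"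
  "product_amplitude d a (\<lambda>x. v x / c) = product_amplitude d a v / c"
  by (simp_all add: product_amplitude_def distrib_left right_diff_distrib sum.distrib
      sum_subtractf sum_divide_distrib)

section \<open>Expansion of the five states in the product basis\<close>

lemma ket_tensor_ket:
  assumes "a' < 2" "b' < 2" "c' < 2"
  shows "ket a b c (\<lambda>p. x p div 2) * ket a' b' c' (\<lambda>p. x p mod 2) =
    ket (2 * a + a') (2 * b + b') (2 * c + c') x"
proof -
  have div_mod: "m div 2 = i \<and> m mod 2 = j \<longleftrightarrow> m = 2 * i + j" if "j < 2" for m i j :: nat
    using that by auto
  have "(if p \<and> q \<and> r then 1 else 0) * (if p' \<and> q' \<and> r' then 1 else 0) =
      (if (p \<and> p') \<and> (q \<and> q') \<and> (r \<and> r') then 1 else (0::complex))" for p q r p' q' r'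
    by simp
  then show ?thesis
    by (simp only: ket_def div_mod assms)
qed

lemma ghz_pm_tensor_ghz_pm:
  assumes "a \<le> 1" "b \<le> 1" "c \<le> 1" "a' \<le> 1" "b' \<le> 1" "c' \<le> 1"
  shows "ghz_pm \<sigma> a b c \<otimes>\<^sub>q ghz_pm \<tau> a' b' c' = (\<lambda>x.
    (ket (2 * a + a') (2 * b + b') (2 * c + c') x +
     \<tau> * ket (2 * a + (1 - a')) (2 * b + (1 - b')) (2 * c + (1 - c')) x +
     \<sigma> * ket (2 * (1 - a) + a') (2 * (1 - b) + b') (2 * (1 - c) + c') x +
     \<sigma> * \<tau> * ket (2 * (1 - a) + (1 - a')) (2 * (1 - b) + (1 - b')) (2 * (1 - c) + (1 - c')) x) / 2)"
proof
  fix x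
  have sqrt2: "complex_of_real (sqrt 2) * complex_of_real (sqrt 2) = 2"
    by (simp flip: of_real_mult)
  have expand: "(k + \<sigma> * l) / complex_of_real (sqrt 2) * ((k' + \<tau> * l') / complex_of_real (sqrt 2)) =
      (k * k' + \<tau> * (k * l') + \<sigma> * (l * k') + \<sigma> * \<tau> * (l * l')) / 2" for k l k' l'
    by (simp add: sqrt2 algebra_simps)
  have less_2: "m < 2" "1 - m < 2" if "m \<le> 1" for m :: nat
    using that by auto
  show "(ghz_pm \<sigma> a b c \<otimes>\<^sub>q ghz_pm \<tau> a' b' c') x =
    (ket (2 * a + a') (2 * b + b') (2 * c + c') x +
     \<tau> * ket (2 * a + (1 - a')) (2 * b + (1 - b')) (2 * c + (1 - c')) x +
     \<sigma> * ket (2 * (1 - a) + a') (2 * (1 - b) + b') (2 * (1 - c) + c') x +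
     \<sigma> * \<tau> * ket (2 * (1 - a) + (1 - a')) (2 * (1 - b) + (1 - b')) (2 * (1 - c) + (1 - c')) x) / 2"
    using assms by (simp only: tensor_qubits_def ghz_pm_def expand ket_tensor_ket less_2)
qed

text \<open>Numbering starts at 0: \<open>T5_state 0\<close>, ..., \<open>T5_state 4\<close> have
  the amplitudes called s1, ..., s5 in the overview.\<close>

definition T5_state :: "nat \<Rightarrow> party tensor" where
  "T5_state i = [ghz 0 \<otimes>\<^sub>q ghz 1, ghz 0 \<otimes>\<^sub>q ghz 6, ghz 0 \<otimes>\<^sub>q ghz 3,
    ghz 3 \<otimes>\<^sub>q ghz 0, ghz 4 \<otimes>\<^sub>q ghz 0] ! i"

lemma T5_eq_image: "T5 = T5_state ` {..<5}"
  by (auto simp: T5_def T5_state_def lessThan_nat_numeral lessThan_Suc)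

lemma T5_state_eq:
  "T5_state 0 = (\<lambda>x. (ket 0 0 1 x + ket 1 1 0 x + ket 2 2 3 x + ket 3 3 2 x) / 2)"
  "T5_state (Suc 0) = (\<lambda>x. (ket 0 0 1 x - ket 1 1 0 x + ket 2 2 3 x - ket 3 3 2 x) / 2)"
  "T5_state 2 = (\<lambda>x. (ket 0 1 1 x + ket 1 0 0 x + ket 2 3 3 x + ket 3 2 2 x) / 2)"
  "T5_state 3 = (\<lambda>x. (ket 0 2 2 x + ket 1 3 3 x + ket 2 0 0 x + ket 3 1 1 x) / 2)"
  "T5_state 4 = (\<lambda>x. (ket 0 2 2 x + ket 1 3 3 x - ket 2 0 0 x - ket 3 1 1 x) / 2)"
  by (simp_all add: T5_state_def ghz_def ghz_pm_tensor_ghz_pm numeral_3_eq_3)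

lemma less_5_cases:
  assumes "i < (5::nat)"
  obtains "i = 0" | "i = 1" | "i = 2" | "i = 3" | "i = 4"
  using assms by linarith

lemma ip_T5_state:
  assumes "i < 5" "j < 5"
  shows "ip (\<lambda>_. 4) (T5_state i) (T5_state j) = (if i = j then 1 else 0)"
  by (rule less_5_cases[OF assms(1)]; rule less_5_cases[OF assms(2)];
      simp add: T5_state_eq ip_linear ip_ket)

lemma inj_on_T5_state: "inj_on T5_state {..<5}"
proof (rule inj_onI)
  fix i j
  assume "i \<in> {..<5}" "j \<in> {..<5}" "T5_state i = T5_state j"
  then show "i = j"
    using ip_T5_state[of i i] ip_T5_state[of i j] by (auto split: if_splits)
qed

lemma ip_self: "ip d v v = complex_of_real (norm_sq d v)"
  by (simp add: ip_def norm_sq_def complex_norm_square mult.commute del: of_real_power)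

lemma is_state_T5_state:
  assumes "i < 5"
  shows "is_state (\<lambda>_. 4) (T5_state i)"
proof -
  have "norm_sq (\<lambda>_. 4) (T5_state i) = 1"
    using ip_T5_state[OF assms assms] by (simp add: ip_self)
  moreover have "T5_state i x = 0" if "x \<notin> configs UNIV (\<lambda>_. 4)" for x
    by (rule less_5_cases[OF assms]) (simp_all add: T5_state_eq ket_outside_configs[OF _ _ _ that])
  ultimately show ?thesis
    by (simp add: is_state_def)
qed

lemma orthogonal_states_T5: "orthogonal_states (\<lambda>_. 4) T5"
  unfolding orthogonal_states_def pairwise_def T5_eq_image
  by (auto simp: is_state_T5_state ip_T5_state)

subsection \<open>Full separation\<close>

text \<open>Here \<open>p + q\<close> and \<open>r + s\<close> are the two halves of a state's
  amplitude. The triangle inequality leaves four products of terms, each rewritten by the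
  assumptions and bounded by AM-GM.\<close>

lemma cross_products_bound:
  fixes p q r s :: complex
  assumes "p * r = x1 * y1" "p * s = x2 * y2" "q * r = x3 * y3" "q * s = x4 * y4"
  shows "2 * (cmod (p + q) * cmod (r + s)) \<le>
    ((cmod x1)\<^sup>2 + (cmod y1)\<^sup>2) + ((cmod x2)\<^sup>2 + (cmod y2)\<^sup>2) +
    ((cmod x3)\<^sup>2 + (cmod y3)\<^sup>2) + ((cmod x4)\<^sup>2 + (cmod y4)\<^sup>2)"
proof -
  have "cmod (p + q) * cmod (r + s) \<le> (cmod p + cmod q) * (cmod r + cmod s)"
    by (intro mult_mono norm_triangle_ineq) auto
  also have "\<dots> = cmod (p * r) + cmod (p * s) + cmod (q * r) + cmod (q * s)"
    by (simp add: norm_mult algebra_simps)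
  also have "\<dots> = cmod x1 * cmod y1 + cmod x2 * cmod y2 + cmod x3 * cmod y3 + cmod x4 * cmod y4"
    by (simp add: assms norm_mult)
  finally show ?thesis
    using sum_squares_bound[of "cmod x1" "cmod y1"] sum_squares_bound[of "cmod x2" "cmod y2"]
      sum_squares_bound[of "cmod x3" "cmod y3"] sum_squares_bound[of "cmod x4" "cmod y4"]
    by linarith
qed

text \<open>Cauchy-Schwarz against the unit vector with four entries 1/2.\<close>

lemma cmod_half_sum_4_sq_le:
  "(cmod ((w + x + y + z) / 2))\<^sup>2 \<le> (cmod w)\<^sup>2 + (cmod x)\<^sup>2 + (cmod y)\<^sup>2 + (cmod z)\<^sup>2"
proof -
  have "cmod (w + x + y + z) \<le> cmod w + cmod x + cmod y + cmod z"
    by (meson add_right_mono norm_triangle_ineq order_trans)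
  then have "(cmod (w + x + y + z))\<^sup>2 \<le> (cmod w + cmod x + cmod y + cmod z)\<^sup>2"
    by (intro power_mono) auto
  also have "\<dots> \<le> 4 * ((cmod w)\<^sup>2 + (cmod x)\<^sup>2 + (cmod y)\<^sup>2 + (cmod z)\<^sup>2)"
    using sum_squares_bound[of "cmod w" "cmod x"] sum_squares_bound[of "cmod w" "cmod y"]
      sum_squares_bound[of "cmod w" "cmod z"] sum_squares_bound[of "cmod x" "cmod y"]
      sum_squares_bound[of "cmod x" "cmod z"] sum_squares_bound[of "cmod y" "cmod z"]
    by (simp add: power2_eq_square algebra_simps)
  finally show ?thesis
    by (simp add: norm_divide power_divide)
qed

text \<open>The factors available in the amplitude bound: 1 from Cauchy-Schwarz for the middle
  state, 2 from the exchange argument for the others.\<close>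

definition T5_weight :: "party tensor \<Rightarrow> real" where
  "T5_weight \<psi> = (if \<psi> = T5_state 2 then 1 else 2)"

lemma T5_weight_state: "i < 5 \<Longrightarrow> T5_weight (T5_state i) = (if i = 2 then 1 else 2)"
  using inj_on_T5_state by (auto simp: T5_weight_def inj_on_def)

text \<open>
  The basis vectors \<open>|x> \<otimes> |y>\<close>, in two qubits per party, with \<open>x \<in> {000, 111}\<close>, \<open>y \<in> {011, 100}\<close>
  in the first row and with \<open>x \<in> {001, 110}\<close>, \<open>y \<in> {000, 111}\<close> in the second.
\<close>

definition witness_labels :: "(nat \<times> nat \<times> nat) set" where
  "witness_labels = {(0, 1, 1), (1, 0, 0), (2, 3, 3), (3, 2, 2),
                     (0, 0, 2), (1, 1, 3), (2, 2, 0), (3, 3, 1)}"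

definition witness_kets :: "party tensor set" where
  "witness_kets = (\<lambda>(a, b, c). ket a b c) ` witness_labels"

lemma sum_witness_kets:
  "(\<Sum>y\<in>witness_kets. f y) =
    f (ket 0 1 1) + f (ket 1 0 0) + f (ket 2 3 3) + f (ket 3 2 2) +
    f (ket 0 0 2) + f (ket 1 1 3) + f (ket 2 2 0) + f (ket 3 3 1)"
proof -
  have "(\<Sum>y\<in>witness_kets. f y) = (\<Sum>t\<in>witness_labels. f ((\<lambda>(a, b, c). ket a b c) t))"
    unfolding witness_kets_def by (rule sum.reindex_cong[OF inj_on_subset[OF inj_ket]]) auto
  then show ?thesis
    by (simp add: witness_labels_def add.assoc)
qed

lemma amplitude_bound:
  assumes "i < 5" and "\<And>j. j < 5 \<Longrightarrow> j \<noteq> i \<Longrightarrow> product_amplitude (\<lambda>_. 4) a (T5_state j) = 0"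
  shows "T5_weight (T5_state i) * (cmod (product_amplitude (\<lambda>_. 4) a (T5_state i)))\<^sup>2 \<le>
    (\<Sum>y\<in>witness_kets. (cmod (product_amplitude (\<lambda>_. 4) a y))\<^sup>2)" (is "?l \<le> ?N")
proof -
  let ?m = "\<lambda>i j l. a Alice i * a Bob j * a Charlie l"
  let ?s = "\<lambda>i. product_amplitude (\<lambda>_. 4) a (T5_state i)"
  define t t' u u' where "t = ?m 0 0 1 + ?m 2 2 3" and "t' = ?m 1 1 0 + ?m 3 3 2"
    and "u = ?m 0 2 2 + ?m 1 3 3" and "u' = ?m 2 0 0 + ?m 3 1 1"
  have N: "?N = (cmod (?m 0 1 1))\<^sup>2 + (cmod (?m 1 0 0))\<^sup>2 + (cmod (?m 2 3 3))\<^sup>2 + (cmod (?m 3 2 2))\<^sup>2 +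
      (cmod (?m 0 0 2))\<^sup>2 + (cmod (?m 1 1 3))\<^sup>2 + (cmod (?m 2 2 0))\<^sup>2 + (cmod (?m 3 3 1))\<^sup>2"
    by (simp add: sum_witness_kets product_amplitude_ket)
  have s: "?s 0 = (t + t') / 2" "?s (Suc 0) = (t - t') / 2" "?s 3 = (u + u') / 2" "?s 4 = (u - u') / 2"
    "?s 2 = (?m 0 1 1 + ?m 1 0 0 + ?m 2 3 3 + ?m 3 2 2) / 2"
    by (simp_all add: T5_state_eq product_amplitude_linear product_amplitude_ket
        t_def t'_def u_def u'_def)
  \<comment> \<open>Bob's labels are exchanged in the first and last product, Charlie's in the other
    two. Each of the eight witnesses then occurs exactly once.\<close>
  have tt': "2 * (cmod t * cmod t') \<le> ?N"
    unfolding N t_def t'_def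
    by (rule order_trans[OF cross_products_bound[of _ _ "?m 0 1 1" "?m 1 0 0" _ "?m 0 0 2" "?m 3 3 1"
          _ "?m 2 2 0" "?m 1 1 3" "?m 2 3 3" "?m 3 2 2"]]) (simp_all add: mult_ac)
  \<comment> \<open>Here Bob's labels are exchanged in the first and last product and Alice's in the
    other two, again giving each witness once.\<close>
  have uu': "2 * (cmod u * cmod u') \<le> ?N"
    unfolding N u_def u'_def
    by (rule order_trans[OF cross_products_bound[of _ _ "?m 0 0 2" "?m 2 2 0" _ "?m 0 1 1" "?m 3 2 2"
          _ "?m 1 0 0" "?m 2 3 3" "?m 1 1 3" "?m 3 3 1"]]) (simp_all add: mult_ac)
  show ?thesis
  proof (rule less_5_cases[OF assms(1)])
    assume i: "i = 0"
    \<comment> \<open>The vanishing partner amplitude \<open>(t - t') / 2\<close> makes the halves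
      equal, so the squared amplitude is the product of their moduli. The other three sign pairs
      work alike.\<close>
    with assms(2)[of 1] have "t = t'"
      by (simp add: s)
    with tt' show ?thesis
      by (simp add: T5_weight_state i s power2_eq_square)
  next
    assume i: "i = 1"
    with assms(2)[of 0] have "t' = - t"
      by (simp add: s add_eq_0_iff)
    with tt' show ?thesis
      by (simp add: T5_weight_state i s power2_eq_square)
  next
    assume i: "i = 2"
    \<comment> \<open>The four kets of \<open>T5_state 2\<close> are themselves witnesses; the
      remaining squares are nonnegative.\<close>
    have "(cmod (?s 2))\<^sup>2 \<le> ?N"
      unfolding N s using cmod_half_sum_4_sq_le[of "?m 0 1 1" "?m 1 0 0" "?m 2 3 3" "?m 3 2 2"]
      by (smt (verit) zero_le_power2)
    then show ?thesis
      by (simp add: T5_weight_state i)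
  next
    assume i: "i = 3"
    with assms(2)[of 4] have "u = u'"
      by (simp add: s)
    with uu' show ?thesis
      by (simp add: T5_weight_state i s power2_eq_square)
  next
    assume i: "i = 4"
    with assms(2)[of 3] have "u' = - u"
      by (simp add: s add_eq_0_iff)
    with uu' show ?thesis
      by (simp add: T5_weight_state i s power2_eq_square)
  qed
qed

lemma not_locally_distinguishable_T5:
  assumes "\<And>S. S \<in> P \<Longrightarrow> \<exists>p. S = {p}"
  shows "\<not> locally_distinguishable P (\<lambda>_. 4) T5"
proof
  assume dist: "locally_distinguishable P (\<lambda>_. 4) T5"
  have "sum T5_weight T5 \<le> sum (norm_sq (\<lambda>_. 4)) witness_kets"
  proof (rule locally_distinguishable_bound[OF _ _ _ _ _ dist])
    show "\<exists>p. S = {p}" if "S \<in> P" for S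
      using assms that .
    show "finite T5"
      by (simp add: T5_def)
    show "is_state (\<lambda>_. 4) \<psi>" if "\<psi> \<in> T5" for \<psi>
      using that orthogonal_states_T5 by (simp add: orthogonal_states_def)
    show "y x = 0" if "y \<in> witness_kets" "x \<notin> configs UNIV (\<lambda>_. 4)" for x y
      using that by (auto simp: witness_kets_def witness_labels_def intro!: ket_outside_configs[of _ 4])
    show "T5_weight \<psi> * (cmod (product_amplitude (\<lambda>_. 4) a \<psi>))\<^sup>2 \<le>
        (\<Sum>y\<in>witness_kets. (cmod (product_amplitude (\<lambda>_. 4) a y))\<^sup>2)"
      if \<psi>: "\<psi> \<in> T5"
        and zero: "\<And>\<phi>. \<phi> \<in> T5 \<Longrightarrow> \<phi> \<noteq> \<psi> \<Longrightarrow> product_amplitude (\<lambda>_. 4) a \<phi> = 0" for a \<psi>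
    proof -
      obtain i where i: "i < 5" "\<psi> = T5_state i"
        using \<psi> by (auto simp: T5_eq_image)
      show ?thesis
        unfolding i(2)
      proof (rule amplitude_bound[OF i(1)])
        fix j :: nat
        assume j: "j < 5" "j \<noteq> i"
        then have "T5_state j \<noteq> \<psi>"
          using i inj_on_T5_state by (auto simp: inj_on_def)
        with j show "product_amplitude (\<lambda>_. 4) a (T5_state j) = 0"
          by (intro zero) (auto simp: T5_eq_image)
      qed
    qed
  qed
  moreover have "sum T5_weight T5 = 9"
  proof -
    have "sum T5_weight T5 = (\<Sum>i<5. T5_weight (T5_state i))"
      unfolding T5_eq_image by (rule sum.reindex_cong[OF inj_on_T5_state]) auto
    then show ?thesis
      by (simp add: T5_weight_state lessThan_nat_numeral lessThan_Suc)
  qed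
  \<comment> \<open>The eight witnesses are unit vectors, so the bound would read 9 \<le> 8.\<close>
  ultimately show False
    by (simp add: sum_witness_kets norm_sq_ket)
qed

subsection \<open>Bipartitions\<close>

lemma restrict_const_singleton: "y \<in> configs {p} d \<Longrightarrow> restrict (\<lambda>_. y p) {p} = y"
  by (auto simp: configs_def PiE_iff extensional_def)

lemma sum_configs_singleton:
  "(\<Sum>y\<in>configs {p} d. f y) = (\<Sum>j<d p. f (restrict (\<lambda>_. j) {p}))"
  by (rule sum.reindex_bij_witness[of _ "\<lambda>j. restrict (\<lambda>_. j) {p}" "\<lambda>y. y p"])
     (auto simp: restrict_const_singleton, auto simp: configs_def)

text \<open>
  Row \<open>k = 2 * u + v\<close> has the entries \<open>(-1)^(i * j + u * i + v * j) / 2\<close> at \<open>2 * i + j\<close>. These are the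
  joint eigenvectors of the Pauli operators \<open>ZX\<close> and \<open>XZ\<close> (hence of \<open>YY\<close>). Two of the five states
  that the other two parties cannot tell apart by parities are related by one of \<open>ZI\<close>, \<open>IZ\<close>, \<open>IX\<close>,
  \<open>IY\<close>, \<open>XX\<close>, \<open>YX\<close> on the measuring party, and each of these has expectation 0 in every row.
\<close>

definition graph_basis :: "nat \<Rightarrow> nat \<Rightarrow> complex" where
  "graph_basis k j = [[1, 1, 1, -1], [1, -1, 1, 1], [1, 1, -1, 1], [1, -1, -1, -1]] ! k ! j / 2"

lemma graph_basis_simps:
  "graph_basis 0 0 = 1 / 2" "graph_basis 0 (Suc 0) = 1 / 2"
  "graph_basis 0 2 = 1 / 2" "graph_basis 0 3 = - 1 / 2"
  "graph_basis (Suc 0) 0 = 1 / 2" "graph_basis (Suc 0) (Suc 0) = - 1 / 2"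
  "graph_basis (Suc 0) 2 = 1 / 2" "graph_basis (Suc 0) 3 = 1 / 2"
  "graph_basis 2 0 = 1 / 2" "graph_basis 2 (Suc 0) = 1 / 2"
  "graph_basis 2 2 = - 1 / 2" "graph_basis 2 3 = 1 / 2"
  "graph_basis 3 0 = 1 / 2" "graph_basis 3 (Suc 0) = - 1 / 2"
  "graph_basis 3 2 = - 1 / 2" "graph_basis 3 3 = - 1 / 2"
  by (simp_all add: graph_basis_def numeral_2_eq_2 numeral_3_eq_3)

text \<open>A row vector, since the output space has dimension 1; the ignored argument is its only
  row label.\<close>

definition graph_measurement :: "party \<Rightarrow> nat \<Rightarrow> party operator" where
  "graph_measurement p k = (\<lambda>_ y. graph_basis k (y p))"

lemma sum_less_4: "(\<Sum>k<4. f k) = f 0 + f (Suc 0) + f 2 + f (3::nat)"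
  by (simp add: lessThan_nat_numeral lessThan_Suc add_ac)

text \<open>The sum runs over rows: this is the completeness relation demanded of a
  measurement.\<close>

lemma graph_basis_orthonormal:
  assumes "i < 4" "j < 4"
  shows "(\<Sum>k<4. cnj (graph_basis k i) * graph_basis k j) = (if i = j then 1 else 0)"
proof -
  have "i \<in> {0, 1, 2, 3}" "j \<in> {0, 1, 2, 3}"
    using assms by auto
  then show ?thesis
    by (auto simp: sum_less_4 graph_basis_simps)
qed

lemma less_4_cases:
  assumes "i < (4::nat)"
  obtains "i = 0" | "i = 1" | "i = 2" | "i = 3"
  using assms by linarith

lemma measurement_graph:
  "measurement {p} (\<lambda>_. 4) 4 (\<lambda>_ _. 1) (graph_measurement p)"
  unfolding measurement_def
proof (intro ballI)
  fix y z :: "party \<Rightarrow> nat"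
  assume yz: "y \<in> configs {p} (\<lambda>_. 4)" "z \<in> configs {p} (\<lambda>_. 4)"
  then have "y p < 4" "z p < 4"
    by (auto simp: configs_def)
  moreover have "y = z \<longleftrightarrow> y p = z p"
    using yz restrict_const_singleton by metis
  ultimately show "(\<Sum>k<4. \<Sum>x\<in>configs {p} (\<lambda>_. 1). cnj (graph_measurement p k x y) *
      graph_measurement p k x z) = (if y = z then 1 else 0)"
    using graph_basis_orthonormal[of "y p" "z p"]
    unfolding sum_configs_singleton graph_measurement_def by simp
qed

section \<open>Residual states of the two other parties\<close>

lemma apply_block_graph:
  "apply_block {p} (\<lambda>_. 4) (graph_measurement p k) v x = (\<Sum>j<4. graph_basis k j * v (x(p := j)))"
proof -
  have "override_on x (restrict (\<lambda>_. j) {p}) {p} = x(p := j)" for j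
    by (auto simp: override_on_def)
  then show ?thesis
    by (simp add: apply_block_def sum_configs_singleton graph_measurement_def)
qed

lemma apply_block_graph_ket:
  "a < 4 \<Longrightarrow> apply_block {Alice} (\<lambda>_. 4) (graph_measurement Alice k) (ket a b c) x =
    (if x Bob = b \<and> x Charlie = c then graph_basis k a else 0)"
  "b < 4 \<Longrightarrow> apply_block {Bob} (\<lambda>_. 4) (graph_measurement Bob k) (ket a b c) x =
    (if x Alice = a \<and> x Charlie = c then graph_basis k b else 0)"
  "c < 4 \<Longrightarrow> apply_block {Charlie} (\<lambda>_. 4) (graph_measurement Charlie k) (ket a b c) x =
    (if x Alice = a \<and> x Bob = b then graph_basis k c else 0)"
  by (auto simp: apply_block_graph ket_def if_distrib[of "\<lambda>t. _ * t"] cong: if_cong)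

lemma sum_delta2:
  fixes g h :: complex and b c m n :: nat
  assumes "b < m" "c < n"
  shows "(\<Sum>j<m. \<Sum>l<n. cnj (if j = b \<and> l = c then g else 0) * (if j = b' \<and> l = c' then h else 0)) =
    (if b = b' \<and> c = c' then cnj g * h else 0)"
proof -
  define z where "z = (if b = b' \<and> c = c' then cnj g * h else 0)"
  have "cnj (if j = b \<and> l = c then g else 0) * (if j = b' \<and> l = c' then h else 0) =
      (if j = b then if l = c then z else 0 else 0)" for j l
    by (auto simp: z_def)
  then have "(\<Sum>j<m. \<Sum>l<n. cnj (if j = b \<and> l = c then g else 0) * (if j = b' \<and> l = c' then h else 0)) =
      (\<Sum>j<m. if j = b then \<Sum>l<n. if l = c then z else 0 else 0)"
    by (simp only:) (intro sum.cong refl, simp)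
  also have "\<dots> = z"
    using assms by simp
  finally show ?thesis
    by (simp add: z_def)
qed

lemma ip_graph_residual_kets:
  assumes "a < 4" "b < 4" "c < 4" "a' < 4" "b' < 4" "c' < 4"
  shows "ip (override_on (\<lambda>_. 4) (\<lambda>_. 1) {p})
      (apply_block {p} (\<lambda>_. 4) (graph_measurement p k) (ket a b c))
      (apply_block {p} (\<lambda>_. 4) (graph_measurement p k) (ket a' b' c')) =
    (case p of
      Alice \<Rightarrow> if b = b' \<and> c = c' then cnj (graph_basis k a) * graph_basis k a' else 0
    | Bob \<Rightarrow> if a = a' \<and> c = c' then cnj (graph_basis k b) * graph_basis k b' else 0
    | Charlie \<Rightarrow> if a = a' \<and> b = b' then cnj (graph_basis k c) * graph_basis k c' else 0)"
  by (cases p; simp only: ip_def sum_configs_party; use assms in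
      \<open>simp add: override_on_def apply_block_graph_ket sum_delta2\<close>)

text \<open>Only pairs of kets that agree for both unmeasured parties contribute. Either there are
  none, or their products of entries, each 1/4 or -1/4, cancel with the signs of the states. For
  Alice, \<open>T5_state 2\<close> and \<open>T5_state 3\<close>, the products of entries 0 and 3
  and of entries 1 and 2 have opposite signs in every row.\<close>

lemma graph_residuals_orthogonal:
  assumes "k < 4" "i < 5" "j < 5" "i \<noteq> j"
  shows "ip (override_on (\<lambda>_. 4) (\<lambda>_. 1) {p})
    (apply_block {p} (\<lambda>_. 4) (graph_measurement p k) (T5_state i))
    (apply_block {p} (\<lambda>_. 4) (graph_measurement p k) (T5_state j)) = 0"
  by (rule less_5_cases[OF assms(2)]; rule less_5_cases[OF assms(3)]; use assms(4) in
      \<open>simp add: T5_state_eq apply_block_linear ip_linear ip_graph_residual_kets[simplified]\<close>;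
      rule less_4_cases[OF assms(1)]; cases p; simp add: graph_basis_simps)

lemma locally_distinguishable_T5:
  assumes "{p} \<in> P" "- {p} \<in> P"
  shows "locally_distinguishable P (\<lambda>_. 4) T5"
proof (rule locally_distinguishable_two_blocks[OF assms])
  show "finite T5"
    by (simp add: T5_def)
  show "is_state (\<lambda>_. 4) \<psi>" if "\<psi> \<in> T5" for \<psi>
    using that orthogonal_states_T5 by (simp add: orthogonal_states_def)
  show "measurement {p} (\<lambda>_. 4) 4 (\<lambda>_ _. 1) (graph_measurement p)"
    by (rule measurement_graph)
  show "ip (override_on (\<lambda>_. 4) (\<lambda>_. 1) {p})
      (apply_block {p} (\<lambda>_. 4) (graph_measurement p k) \<phi>)
      (apply_block {p} (\<lambda>_. 4) (graph_measurement p k) \<psi>) = 0"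
    if "k < 4" "\<phi> \<in> T5" "\<psi> \<in> T5" "\<phi> \<noteq> \<psi>" for k \<phi> \<psi>
    using that graph_residuals_orthogonal by (auto simp: T5_eq_image)
qed

section \<open>Partitions of three parties and the threshold property\<close>

theorem theorem3:
  shows "card T5 = 5 \<and> threshold_set 2 3 (\<lambda>_. 4) T5"
proof -
  have "locally_distinguishable P (\<lambda>_. 4) T5"
    if part: "partition_on UNIV P" and S: "S \<in> P" "2 \<le> card S" for P S
  proof (cases "S = UNIV")
    case True
    then show ?thesis
      using S orthogonal_states_T5
      by (intro locally_distinguishable_one_block) (auto simp: T5_def)
  next
    case False
    then have "card S < 3"
      using psubset_card_mono[of UNIV S] by (auto simp: card_UNIV_party)
    \<comment> \<open>A proper block of size at least 2 leaves out one party, whose block is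
      disjoint from \<open>S\<close> and hence a singleton: the partition is a bipartition.\<close>
    then have "card (- S) = 1"
      using S(2) by (simp add: Compl_eq_Diff_UNIV card_Diff_subset card_UNIV_party)
    then obtain p where p: "- S = {p}"
      by (rule card_1_singletonE)
    then obtain R where R: "R \<in> P" "p \<in> R"
      using partition_onD1[OF part] by blast
    then have "R \<inter> S = {}"
      using p S(1) partition_onD2[OF part] by (auto simp: disjoint_def)
    then have "R = {p}"
      using p R(2) by blast
    moreover have "- {p} = S"
      using p by blast
    ultimately show ?thesis
      using R(1) S(1) by (intro locally_distinguishable_T5[of p]) auto
  qed
  moreover have "\<not> locally_distinguishable P (\<lambda>_. 4) T5"
    if part: "partition_on UNIV P" and small: "\<forall>S\<in>P. card S \<le> 2 - 1" for P
  proof (rule not_locally_distinguishable_T5)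
    fix S
    assume S: "S \<in> P"
    \<comment> \<open>Blocks of a partition are nonempty, so the size bound \<open>2 - 1\<close>
      forces singletons.\<close>
    then have "S \<noteq> {}"
      using partition_onD3[OF part] by blast
    then have "card S = 1"
      using small S by (fastforce simp: card_gt_0_iff le_Suc_eq)
    then show "\<exists>p. S = {p}"
      by (rule card_1_singletonE) blast
  qed
  moreover have "card T5 = 5"
    unfolding T5_eq_image by (simp add: card_image inj_on_T5_state)
  ultimately show ?thesis
    unfolding threshold_set_def using orthogonal_states_T5 by (auto simp: card_UNIV_party)
qed

end
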